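(* The algebra $\mathcal{P}$ is a free polynomial algebra (over $\mathbb{Q}$) on the set $[\mathcal{G}^c]=\{[H] : H \text{ a connected finite simple graph}\}$. That is, the functions $[H]$, for $H$ ranging over isomorphism classes of connected finite simple graphs, are algebraically independent over $\mathbb{Q}$ and generate $\mathcal{P}$ as a $\mathbb{Q}$-algebra.
   Context: $\mathcal{G}$ is the set of isomorphism classes of finite simple graphs (no loops, no multiple edges), including the empty graph; $\mathcal{G}^c$ is the subset of (nonempty) connected graphs. For $H,G\in\mathcal{G}$, an embedding $H\to G$ is an injection $f:V(H)\to V(G)$ such that for all $v,v'\in V(H)$, $(v,v')$ is an edge of $H$ if and only if $(f(v),f(v'))$ is an edge of $G$. $i(H,G)$ is the number of embeddings of $H$ in $G$ divided by the number of automorphisms of $H$ (equivalently, the number of subsets $S\subseteq V(G)$ with $G[S]\cong H$). $[H]:\mathcal{G}\to\mathbb{N}$ is the function $G\mapsto i(H,G)$; thus $[\emptyset]$ is the constant function $1$. $\mathcal{P}$ is the $\mathbb{Q}$-vector space spanned by $\{[H]: H\in\mathcal{G}\}$ inside the functions $\mathcal{G}\to\mathbb{Q}$; it is closed under pointwise multiplication and so is a commutative $\mathbb{Q}$-algebra. *)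

theory Defs
  imports
    Complex_Main
    "HOL-Library.FuncSet"
    "HOL-Library.Function_Algebras"
    "HOL-Library.Poly_Mapping"
    "Graph_Theory.Pair_Digraph"
    "Graph_Theory.Digraph_Component"
    "Graph_Theory.Digraph_Isomorphism"
begin

section \<open>Embeddings of finite simple graphs\<close>

text \<open>
  A finite simple graph is a \<open>pair_graph\<close>: a finite, loop-free, symmetric set of arcs on a finite
  (possibly empty) set of vertices, an edge between \<open>u\<close> and \<open>v\<close> being the pair of arcs
  \<open>(u, v)\<close> and \<open>(v, u)\<close>.
\<close>

text \<open>
  Embeddings are taken extensional (\<open>undefined\<close> off the vertex set of the source), so that they
  can be counted.
\<close>

definition embeddings :: "'a pair_pre_digraph \<Rightarrow> 'b pair_pre_digraph \<Rightarrow> ('a \<Rightarrow> 'b) set" where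
  "embeddings H G = {f \<in> pverts H \<rightarrow>\<^sub>E pverts G. inj_on f (pverts H) \<and>
     (\<forall>v\<in>pverts H. \<forall>v'\<in>pverts H. (v, v') \<in> parcs H \<longleftrightarrow> (f v, f v') \<in> parcs G)}"

definition automorphisms :: "'a pair_pre_digraph \<Rightarrow> ('a \<Rightarrow> 'a) set" where
  "automorphisms H = {f \<in> embeddings H H. bij_betw f (pverts H) (pverts H)}"

definition induced_count :: "'a pair_pre_digraph \<Rightarrow> 'b pair_pre_digraph \<Rightarrow> rat" where
  "induced_count H G = of_nat (card (embeddings H G)) / of_nat (card (automorphisms H))"


section \<open>Invariance under isomorphism\<close>

definition vertex_iso :: "('a \<Rightarrow> 'b) \<Rightarrow> 'a pair_pre_digraph \<Rightarrow> 'b pair_pre_digraph \<Rightarrow> bool" where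
  "vertex_iso f G H \<longleftrightarrow> bij_betw f (pverts G) (pverts H) \<and>
     (\<forall>u\<in>pverts G. \<forall>v\<in>pverts G. (u, v) \<in> parcs G \<longleftrightarrow> (f u, f v) \<in> parcs H)"

lemma digraph_iso_imp_vertex_iso:
  assumes G: "pair_graph G" and iso: "digraph_iso (with_proj G) (with_proj H)"
  shows "\<exists>f. vertex_iso f G H"
proof -
  interpret pair_graph G by fact
  obtain h where h: "pre_digraph.digraph_isomorphism (with_proj G) h"
    and H: "with_proj H = app_iso h (with_proj G)"
    using iso unfolding digraph_iso_def by blast
  let ?f = "iso_verts h"
  have V: "pverts H = ?f ` pverts G"
    using arg_cong[OF H, of verts] by simp
  have inj: "inj_on ?f (pverts G)"
    using h by (simp add: pre_digraph.digraph_isomorphism_def)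
  have E: "parcs H = (\<lambda>(u, v). (?f u, ?f v)) ` parcs G"
    using arg_cong[OF H, of arcs_ends] wf_digraph.arcs_ends_app_iso_eq[OF wf_digraph_axioms h]
    by simp
  have "(u, v) \<in> parcs G \<longleftrightarrow> (?f u, ?f v) \<in> parcs H" if "u \<in> pverts G" "v \<in> pverts G" for u v
    using that inj unfolding E by (auto dest: in_arcsD1 in_arcsD2 inj_onD)
  then show ?thesis
    using inj V unfolding vertex_iso_def bij_betw_def by blast
qed

lemma vertex_iso_imp_digraph_iso:
  assumes G: "pair_graph G" and H: "pair_graph H" and f: "vertex_iso f G H"
  shows "digraph_iso (with_proj G) (with_proj H)"
proof -
  interpret G: pair_graph G by fact
  interpret H: pair_graph H by fact
  have bij: "bij_betw f (pverts G) (pverts H)"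
    and E: "\<And>u v. u \<in> pverts G \<Longrightarrow> v \<in> pverts G \<Longrightarrow> (u, v) \<in> parcs G \<longleftrightarrow> (f u, f v) \<in> parcs H"
    using f unfolding vertex_iso_def by auto
  have inj: "inj_on f (pverts G)" and im: "f ` pverts G = pverts H"
    using bij unfolding bij_betw_def by auto
  define h where
    "h = \<lparr>iso_verts = f, iso_arcs = (\<lambda>(u, v). (f u, f v)), iso_head = snd, iso_tail = fst\<rparr>"
  have "inj_on (\<lambda>(u, v). (f u, f v)) (parcs G)"
    using inj by (auto intro!: inj_onI dest: inj_onD G.in_arcsD1 G.in_arcsD2)
  then have "pre_digraph.digraph_isomorphism (with_proj G) h"
    using G.wf_digraph_axioms inj unfolding pre_digraph.digraph_isomorphism_def h_def by auto
  moreover have "(\<lambda>(u, v). (f u, f v)) ` parcs G = parcs H"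
  proof (intro equalityI subsetI)
    fix e assume "e \<in> parcs H"
    obtain x y where e: "e = (x, y)" "x \<in> pverts H" "y \<in> pverts H" "(x, y) \<in> parcs H"
      using \<open>e \<in> parcs H\<close> H.in_arcsD1 H.in_arcsD2 by (cases e) auto
    then obtain u v where "u \<in> pverts G" "v \<in> pverts G" "x = f u" "y = f v"
      using im by blast
    with e have "(u, v) \<in> parcs G" "e = (f u, f v)"
      using E[of u v] by simp_all
    then show "e \<in> (\<lambda>(u, v). (f u, f v)) ` parcs G"
      by (intro rev_image_eqI[of "(u, v)"]) simp_all
  next
    fix e assume "e \<in> (\<lambda>(u, v). (f u, f v)) ` parcs G"
    then obtain u v where "(u, v) \<in> parcs G" "e = (f u, f v)"
      by auto
    then show "e \<in> parcs H"
      using E[of u v] G.in_arcsD1[of u v] G.in_arcsD2[of u v] by simp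
  qed
  then have "with_proj H = app_iso h (with_proj G)"
    using im by (simp add: app_iso_def with_proj_def h_def)
  ultimately show ?thesis
    unfolding digraph_iso_def by blast
qed

lemma digraph_iso_iff_vertex_iso:
  assumes "pair_graph G" "pair_graph H"
  shows "digraph_iso (with_proj G) (with_proj H) \<longleftrightarrow> (\<exists>f. vertex_iso f G H)"
  using assms digraph_iso_imp_vertex_iso vertex_iso_imp_digraph_iso by blast

lemma vertex_iso_id: "vertex_iso id G G"
  by (simp add: vertex_iso_def)

lemma vertex_iso_inv:
  assumes "vertex_iso f G H"
  shows "vertex_iso (inv_into (pverts G) f) H G"
proof -
  let ?g = "inv_into (pverts G) f"
  have bij: "bij_betw f (pverts G) (pverts H)"
    using assms by (simp add: vertex_iso_def)
  then have g: "bij_betw ?g (pverts H) (pverts G)"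
    by (rule bij_betw_inv_into)
  have "(u, v) \<in> parcs H \<longleftrightarrow> (?g u, ?g v) \<in> parcs G" if "u \<in> pverts H" "v \<in> pverts H" for u v
    using assms bij_betw_apply[OF g that(1)] bij_betw_apply[OF g that(2)]
      bij_betw_inv_into_right[OF bij that(1)] bij_betw_inv_into_right[OF bij that(2)]
    by (simp add: vertex_iso_def)
  with g show ?thesis
    by (simp add: vertex_iso_def)
qed

lemma vertex_iso_comp:
  assumes "vertex_iso f G H" "vertex_iso g H K"
  shows "vertex_iso (g \<circ> f) G K"
proof -
  have bij: "bij_betw f (pverts G) (pverts H)" "bij_betw g (pverts H) (pverts K)"
    using assms by (simp_all add: vertex_iso_def)
  have "(u, v) \<in> parcs G \<longleftrightarrow> (g (f u), g (f v)) \<in> parcs K" if "u \<in> pverts G" "v \<in> pverts G" for u v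
    using assms that bij_betw_apply[OF bij(1) that(1)] bij_betw_apply[OF bij(1) that(2)]
    by (simp add: vertex_iso_def)
  with bij_betw_trans[OF bij] show ?thesis
    by (simp add: vertex_iso_def)
qed

lemma finite_embeddings:
  assumes "pair_graph H" "pair_graph G"
  shows "finite (embeddings H G)"
proof -
  interpret G: pair_graph G by fact
  interpret H: pair_graph H by fact
  have "embeddings H G \<subseteq> pverts H \<rightarrow>\<^sub>E pverts G"
    by (auto simp: embeddings_def)
  then show ?thesis
    using G.pair_finite_verts H.pair_finite_verts by (meson finite_PiE finite_subset)
qed

lemma automorphisms_eq_embeddings:
  assumes "pair_graph H"
  shows "automorphisms H = embeddings H H"
proof -
  interpret H: pair_graph H by fact
  have "bij_betw f (pverts H) (pverts H)" if "f \<in> embeddings H H" for f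
  proof -
    have "f ` pverts H \<subseteq> pverts H" "inj_on f (pverts H)"
      using that by (auto simp: embeddings_def)
    then show ?thesis
      using endo_inj_surj[OF H.pair_finite_verts] by (simp add: bij_betw_def)
  qed
  then show ?thesis
    by (auto simp: automorphisms_def)
qed

lemma embedding_transport:
  assumes h: "h \<in> embeddings H G" and f: "vertex_iso f H' H" and g: "vertex_iso g G G'"
  shows "restrict (g \<circ> h \<circ> f) (pverts H') \<in> embeddings H' G'"
proof -
  have f1: "\<And>x. x \<in> pverts H' \<Longrightarrow> f x \<in> pverts H" "inj_on f (pverts H')"
    and f2: "\<And>u v. u \<in> pverts H' \<Longrightarrow> v \<in> pverts H' \<Longrightarrow>
                (u, v) \<in> parcs H' \<longleftrightarrow> (f u, f v) \<in> parcs H"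
    using f unfolding vertex_iso_def bij_betw_def by auto
  have g1: "\<And>x. x \<in> pverts G \<Longrightarrow> g x \<in> pverts G'" "inj_on g (pverts G)"
    and g2: "\<And>u v. u \<in> pverts G \<Longrightarrow> v \<in> pverts G \<Longrightarrow>
                (u, v) \<in> parcs G \<longleftrightarrow> (g u, g v) \<in> parcs G'"
    using g unfolding vertex_iso_def bij_betw_def by auto
  have h1: "\<And>x. x \<in> pverts H \<Longrightarrow> h x \<in> pverts G" "inj_on h (pverts H)"
    and h2: "\<And>u v. u \<in> pverts H \<Longrightarrow> v \<in> pverts H \<Longrightarrow>
                (u, v) \<in> parcs H \<longleftrightarrow> (h u, h v) \<in> parcs G"
    using h unfolding embeddings_def by auto
  have "inj_on (g \<circ> h \<circ> f) (pverts H')"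
    by (rule inj_onI) (metis comp_apply f1 g1 h1 inj_on_def)
  then have "inj_on (restrict (g \<circ> h \<circ> f) (pverts H')) (pverts H')"
    by (simp add: inj_on_def)
  moreover have "(u, v) \<in> parcs H' \<longleftrightarrow> (g (h (f u)), g (h (f v))) \<in> parcs G'"
    if "u \<in> pverts H'" "v \<in> pverts H'" for u v
    using that by (simp add: f1 f2 g2[symmetric] h1 h2)
  ultimately show ?thesis
    unfolding embeddings_def using f1 g1 h1 by auto
qed

lemma card_embeddings_le:
  assumes H': "pair_graph H'" and G': "pair_graph G'"
    and f: "vertex_iso f H' H" and g: "vertex_iso g G G'"
  shows "card (embeddings H G) \<le> card (embeddings H' G')"
proof (rule card_inj_on_le)
  show "(\<lambda>h. restrict (g \<circ> h \<circ> f) (pverts H')) ` embeddings H G \<subseteq> embeddings H' G'"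
    using embedding_transport[OF _ f g] by auto
  show "finite (embeddings H' G')"
    using H' G' by (rule finite_embeddings)
  show "inj_on (\<lambda>h. restrict (g \<circ> h \<circ> f) (pverts H')) (embeddings H G)"
  proof (rule inj_onI)
    fix h k
    assume h: "h \<in> embeddings H G" and k: "k \<in> embeddings H G"
      and eq: "restrict (g \<circ> h \<circ> f) (pverts H') = restrict (g \<circ> k \<circ> f) (pverts H')"
    have hk: "h \<in> pverts H \<rightarrow>\<^sub>E pverts G" "k \<in> pverts H \<rightarrow>\<^sub>E pverts G"
      using h k by (auto simp: embeddings_def)
    show "h = k"
    proof (rule PiE_ext[OF hk])
      fix y assume y: "y \<in> pverts H"
      then obtain x where x: "x \<in> pverts H'" "y = f x"
        using f unfolding vertex_iso_def bij_betw_def by blast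
      have "g (h y) = g (k y)"
        using fun_cong[OF eq, of x] x by simp
      moreover have "inj_on g (pverts G)"
        using g unfolding vertex_iso_def bij_betw_def by blast
      ultimately show "h y = k y"
        using hk y by (auto dest: inj_onD)
    qed
  qed
qed

lemma card_embeddings_cong:
  assumes "pair_graph H" "pair_graph H'" "pair_graph G" "pair_graph G'"
    and f: "vertex_iso f H H'" and g: "vertex_iso g G G'"
  shows "card (embeddings H G) = card (embeddings H' G')"
  using card_embeddings_le[OF assms(2,4) vertex_iso_inv[OF f] g]
    card_embeddings_le[OF assms(1,3) f vertex_iso_inv[OF g]]
  by simp

lemma induced_count_cong:
  assumes "pair_graph H" "pair_graph H'" "pair_graph G" "pair_graph G'"
    and "vertex_iso f H H'" "vertex_iso g G G'"
  shows "induced_count H G = induced_count H' G'"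
  unfolding induced_count_def automorphisms_eq_embeddings[OF assms(1)]
    automorphisms_eq_embeddings[OF assms(2)]
    card_embeddings_cong[OF assms] card_embeddings_cong[OF assms(1,2,1,2,5,5)] ..

lemma connected_vertex_iso:
  assumes G: "pair_graph G" and H: "pair_graph H" and f: "vertex_iso f G H"
    and c: "Digraph_Component.connected (with_proj G)"
  shows "Digraph_Component.connected (with_proj H)"
proof -
  interpret G: pair_graph G by fact
  obtain h where "pre_digraph.digraph_isomorphism (with_proj G) h"
    and "with_proj H = app_iso h (with_proj G)"
    using vertex_iso_imp_digraph_iso[OF G H f] unfolding digraph_iso_def by blast
  then show ?thesis
    using wf_digraph.connectedI_app_iso[OF G.wf_digraph_axioms c] by simp
qed


section \<open>Isomorphism classes\<close>

definition graph_iso :: "nat pair_pre_digraph \<Rightarrow> nat pair_pre_digraph \<Rightarrow> bool" where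
  "graph_iso G H \<longleftrightarrow> pair_graph G \<and> pair_graph H \<and> digraph_iso (with_proj G) (with_proj H)"

lemma graph_iso_iff_vertex_iso:
  "graph_iso G H \<longleftrightarrow> pair_graph G \<and> pair_graph H \<and> (\<exists>f. vertex_iso f G H)"
  unfolding graph_iso_def using digraph_iso_iff_vertex_iso by blast

lemma pair_graph_empty: "pair_graph \<lparr>pverts = {}, parcs = {}\<rparr>"
  by unfold_locales (auto simp: symmetric_def sym_def)

lemma part_equivp_graph_iso: "part_equivp graph_iso"
proof (rule part_equivpI)
  show "\<exists>G. graph_iso G G"
    using pair_graph_empty vertex_iso_id unfolding graph_iso_iff_vertex_iso by blast
  show "symp graph_iso"
    unfolding symp_def graph_iso_iff_vertex_iso using vertex_iso_inv by blast
  show "transp graph_iso"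
    unfolding transp_def graph_iso_iff_vertex_iso using vertex_iso_comp by blast
qed

text \<open>
  Every finite simple graph is isomorphic to one whose vertices are natural numbers, so
  \<open>graph_class\<close> is the type of all isomorphism classes of finite simple graphs.
\<close>

quotient_type graph_class = "nat pair_pre_digraph" / partial: graph_iso
  by (rule part_equivp_graph_iso)

text \<open>\<open>graph_fun H\<close> is the function \<open>[H]\<close>, mapping \<open>G\<close> to \<open>i(H, G)\<close>.\<close>

lift_definition graph_fun :: "graph_class \<Rightarrow> graph_class \<Rightarrow> rat" is induced_count
  unfolding graph_iso_iff_vertex_iso using induced_count_cong by blast

text \<open>The library's \<open>connected\<close> excludes the empty graph.\<close>

lift_definition connected_class :: "graph_class \<Rightarrow> bool"
  is "\<lambda>G. Digraph_Component.connected (with_proj G)"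
  unfolding graph_iso_iff_vertex_iso using connected_vertex_iso vertex_iso_inv by blast


section \<open>The algebra of rational-valued functions\<close>

text \<open>Addition and multiplication of functions are pointwise, by \<open>Function_Algebras\<close>.\<close>

definition scale_fun :: "rat \<Rightarrow> ('g \<Rightarrow> rat) \<Rightarrow> ('g \<Rightarrow> rat)" where
  "scale_fun c f = (\<lambda>x. c * f x)"

global_interpretation rat_fun: vector_space scale_fun
  by unfold_locales (auto simp: scale_fun_def fun_eq_iff algebra_simps)

definition subalgebra :: "('g \<Rightarrow> rat) set \<Rightarrow> bool" where
  "subalgebra A \<longleftrightarrow> rat_fun.subspace A \<and> 1 \<in> A \<and> (\<forall>f\<in>A. \<forall>g\<in>A. f * g \<in> A)"

text \<open>
  A polynomial over the rationals in variables indexed by \<open>'i\<close> is a finitely supported map from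
  monomials to coefficients, a monomial being a finitely supported map from variables to exponents.
\<close>

type_synonym 'i rat_mpoly = "('i \<Rightarrow>\<^sub>0 nat) \<Rightarrow>\<^sub>0 rat"

definition mpoly_vars :: "'i rat_mpoly \<Rightarrow> 'i set" where
  "mpoly_vars p = (\<Union>m\<in>Poly_Mapping.keys p. Poly_Mapping.keys m)"

definition eval_mpoly :: "('i \<Rightarrow> 'g \<Rightarrow> rat) \<Rightarrow> 'i rat_mpoly \<Rightarrow> ('g \<Rightarrow> rat)" where
  "eval_mpoly F p = (\<Sum>m\<in>Poly_Mapping.keys p.
     scale_fun (Poly_Mapping.lookup p m) (\<Prod>i\<in>Poly_Mapping.keys m. F i ^ Poly_Mapping.lookup m i))"

text \<open>
  This is independence of the indexed family, so that it entails injectivity of \<open>F\<close> on \<open>I\<close>.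
\<close>

definition algebraically_independent :: "'i set \<Rightarrow> ('i \<Rightarrow> 'g \<Rightarrow> rat) \<Rightarrow> bool" where
  "algebraically_independent I F \<longleftrightarrow>
     (\<forall>p. mpoly_vars p \<subseteq> I \<longrightarrow> eval_mpoly F p = 0 \<longrightarrow> p = 0)"

definition graph_algebra :: "(graph_class \<Rightarrow> rat) set" where
  "graph_algebra = rat_fun.span (range graph_fun)"

definition free_polynomial_algebra_on ::
    "('g \<Rightarrow> rat) set \<Rightarrow> 'i set \<Rightarrow> ('i \<Rightarrow> 'g \<Rightarrow> rat) \<Rightarrow> bool" where
  "free_polynomial_algebra_on A I F \<longleftrightarrow>
     algebraically_independent I F \<and> subalgebra hull (F ` I) = A"

end

theory Submission
  imports Defs "HOL-Computational_Algebra.Polynomial"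
begin

text \<open>
  A product \<open>[X] [Y]\<close> counts the pairs of vertex sets inducing \<open>X\<close> and \<open>Y\<close>; sorting them by
  their union writes it as a combination of functions \<open>[Z]\<close>, so the span is an algebra. If a graph is
  disconnected along a cut, it is the leading term of the product of its two parts, and induction shows
  that the connected graphs generate.

  For connected \<open>X\<close> the function \<open>[X]\<close> is additive on disjoint unions. In a polynomial relation between
  connected graphs let \<open>K\<close> be one of least order. Replacing \<open>G\<close> by the disjoint union of \<open>G\<close> with
  \<open>t\<close> copies of \<open>K\<close> adds \<open>t\<close> to the value of \<open>[K]\<close> and leaves the other values unchanged, so the
  relation becomes a polynomial in \<open>t\<close> with infinitely many zeros: the coefficient of each power of
  \<open>[K]\<close> vanishes, and \<open>K\<close> is eliminated.
\<close>

section \<open>Induced subgraphs and their classes\<close>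

text \<open>Trades the locale predicates for elementwise conditions that automation can use.
  Finiteness of the arcs follows from \<open>parcs G\<close> lying in a finite square.\<close>

lemma pair_graph_iff:
  "pair_graph G \<longleftrightarrow> finite (pverts G) \<and> (\<forall>u v. (u, v) \<in> parcs G \<longrightarrow>
     u \<in> pverts G \<and> v \<in> pverts G \<and> u \<noteq> v \<and> (v, u) \<in> parcs G)"
proof
  assume "pair_graph G"
  then interpret pair_graph G .
  show "finite (pverts G) \<and> (\<forall>u v. (u, v) \<in> parcs G \<longrightarrow>
     u \<in> pverts G \<and> v \<in> pverts G \<and> u \<noteq> v \<and> (v, u) \<in> parcs G)"
    using pair_finite_verts in_arcsD1 in_arcsD2 no_loops' arcs_symmetric by blast
next
  assume *: "finite (pverts G) \<and> (\<forall>u v. (u, v) \<in> parcs G \<longrightarrow>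
     u \<in> pverts G \<and> v \<in> pverts G \<and> u \<noteq> v \<and> (v, u) \<in> parcs G)"
  have "finite (parcs G)"
    by (rule finite_subset[of _ "pverts G \<times> pverts G"]) (use * in auto)
  with * show "pair_graph G"
    by unfold_locales (auto simp: symmetric_def sym_def arcs_ends_def arc_to_ends_def)
qed

lemma finite_pverts: "pair_graph G \<Longrightarrow> finite (pverts G)"
  by (simp add: pair_graph_iff)

lemma finite_parcs: "pair_graph G \<Longrightarrow> finite (parcs G)"
  by (rule finite_subset[of _ "pverts G \<times> pverts G"]) (auto simp: pair_graph_iff)

lemma graph_iso_refl_iff [simp]: "graph_iso G G \<longleftrightarrow> pair_graph G"
  unfolding graph_iso_iff_vertex_iso using vertex_iso_id by blast

lemma abs_graph_class_eq_iff:
  assumes "pair_graph G" "pair_graph H"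
  shows "abs_graph_class G = abs_graph_class H \<longleftrightarrow> (\<exists>f. vertex_iso f G H)"
  using Quotient3_rel[OF Quotient3_graph_class, of G H] assms
  by (simp add: graph_iso_iff_vertex_iso)

lemma graph_class_cases:
  obtains G where "pair_graph G" "X = abs_graph_class G"
  by (induct X rule: graph_class.abs_induct) auto

definition induced :: "'a pair_pre_digraph \<Rightarrow> 'a set \<Rightarrow> 'a pair_pre_digraph" where
  "induced G S = \<lparr>pverts = S, parcs = parcs G \<inter> S \<times> S\<rparr>"

lemma induced_simps [simp]:
  "pverts (induced G S) = S" "parcs (induced G S) = parcs G \<inter> S \<times> S"
  by (simp_all add: induced_def)

lemma induced_induced: "A \<subseteq> S \<Longrightarrow> induced (induced G S) A = induced G A"
  by (auto simp: induced_def)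

lemma induced_verts: "pair_graph G \<Longrightarrow> induced G (pverts G) = G"
  by (cases G) (auto simp: induced_def pair_graph_iff)

lemma pair_graph_induced: "pair_graph G \<Longrightarrow> S \<subseteq> pverts G \<Longrightarrow> pair_graph (induced G S)"
  by (auto simp: pair_graph_iff intro: finite_subset)

lemma vertex_iso_induced:
  assumes "vertex_iso f G H" "A \<subseteq> pverts G"
  shows "vertex_iso f (induced G A) (induced H (f ` A))"
proof -
  have "inj_on f A"
    using assms by (auto simp: vertex_iso_def bij_betw_def intro: inj_on_subset)
  then show ?thesis
    using assms by (auto simp: vertex_iso_def bij_betw_def subset_iff)
qed

definition induced_class :: "nat pair_pre_digraph \<Rightarrow> nat set \<Rightarrow> graph_class" where
  "induced_class G S = abs_graph_class (induced G S)"

lemma induced_class_iso: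
  assumes "pair_graph G" "pair_graph H" "vertex_iso f G H" "A \<subseteq> pverts G"
  shows "induced_class H (f ` A) = induced_class G A"
proof -
  have "f ` A \<subseteq> pverts H"
    using assms by (auto simp: vertex_iso_def bij_betw_def)
  then show ?thesis
    unfolding induced_class_def
    using vertex_iso_induced[OF assms(3,4)] assms
    by (subst eq_commute, subst abs_graph_class_eq_iff) (auto intro: pair_graph_induced)
qed

section \<open>Isomorphism invariants and finiteness of the classes of bounded order\<close>

lift_definition class_order :: "graph_class \<Rightarrow> nat" is "\<lambda>G. card (pverts G)"
  by (auto simp: graph_iso_iff_vertex_iso vertex_iso_def bij_betw_same_card)

lemma vertex_iso_arcs:
  assumes "pair_graph G" "pair_graph H" "vertex_iso f G H"
  shows "bij_betw (map_prod f f) (parcs G) (parcs H)"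
  unfolding bij_betw_def
proof
  have bij: "inj_on f (pverts G)" "f ` pverts G = pverts H"
    and E: "\<And>u v. u \<in> pverts G \<Longrightarrow> v \<in> pverts G \<Longrightarrow> (u, v) \<in> parcs G \<longleftrightarrow> (f u, f v) \<in> parcs H"
    using assms(3) by (auto simp: vertex_iso_def bij_betw_def)
  show "inj_on (map_prod f f) (parcs G)"
  proof (rule inj_on_subset)
    show "inj_on (map_prod f f) (pverts G \<times> pverts G)"
      using bij(1) by (simp add: map_prod_inj_on)
    show "parcs G \<subseteq> pverts G \<times> pverts G"
      using assms(1) by (auto simp: pair_graph_iff)
  qed
  show "map_prod f f ` parcs G = parcs H"
  proof (intro equalityI subsetI)
    fix e assume "e \<in> parcs H"
    moreover obtain x y where "e = (x, y)" by (cases e)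
    ultimately obtain u v where "u \<in> pverts G" "v \<in> pverts G" "e = (f u, f v)"
      using bij(2) assms(2) unfolding pair_graph_iff by (metis imageE)
    then show "e \<in> map_prod f f ` parcs G"
      using E \<open>e \<in> parcs H\<close> by (intro rev_image_eqI[of "(u, v)"]) auto
  qed (use assms(1) E in \<open>auto simp: pair_graph_iff\<close>)
qed

text \<open>Arcs are counted in both directions, so this is twice the number of edges; it ranks
  graphs of equal order.\<close>

lift_definition class_size :: "graph_class \<Rightarrow> nat" is "\<lambda>G. card (parcs G)"
  unfolding graph_iso_iff_vertex_iso using vertex_iso_arcs bij_betw_same_card by blast

lemma class_order_induced:
  "pair_graph G \<Longrightarrow> S \<subseteq> pverts G \<Longrightarrow> class_order (induced_class G S) = card S"
  by (simp add: induced_class_def class_order.abs_eq pair_graph_induced)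

lemma class_size_induced:
  "pair_graph G \<Longrightarrow> S \<subseteq> pverts G \<Longrightarrow> class_size (induced_class G S) = card (parcs G \<inter> S \<times> S)"
  by (simp add: induced_class_def class_size.abs_eq pair_graph_induced)

text \<open>Keeps the truncated subtraction in the later induction measure faithful.\<close>

lemma class_size_le: "class_size X \<le> class_order X * class_order X"
proof -
  obtain G where G: "pair_graph G" "X = abs_graph_class G"
    by (rule graph_class_cases)
  have "card (parcs G) \<le> card (pverts G \<times> pverts G)"
    by (rule card_mono) (use G in \<open>auto simp: pair_graph_iff\<close>)
  with G show ?thesis
    by (simp add: class_order.abs_eq class_size.abs_eq card_cartesian_product)
qed

text \<open>A graph of order \<open>k\<close> can be relabelled to have vertex set
  \<open>{..<k}\<close>, which carries finitely many arc sets. This makes the sum in the product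
  formula finite.\<close>

lemma finite_classes_bounded: "finite {X. class_order X \<le> n}"
proof -
  let ?T = "\<lambda>k. {G :: nat pair_pre_digraph. pverts G = {..<k} \<and> parcs G \<subseteq> {..<k} \<times> {..<k}}"
  have fin: "finite (?T k)" for k
  proof (rule finite_subset)
    show "?T k \<subseteq> (\<lambda>E. \<lparr>pverts = {..<k}, parcs = E\<rparr>) ` Pow ({..<k} \<times> {..<k})"
    proof
      fix G :: "nat pair_pre_digraph" assume "G \<in> ?T k"
      then show "G \<in> (\<lambda>E. \<lparr>pverts = {..<k}, parcs = E\<rparr>) ` Pow ({..<k} \<times> {..<k})"
        by (intro rev_image_eqI[of "parcs G"]) auto
    qed
  qed simp
  have "{X. class_order X \<le> n} \<subseteq> abs_graph_class ` (\<Union>k\<in>{..n}. ?T k)"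
  proof
    fix X assume "X \<in> {X. class_order X \<le> n}"
    obtain G where G: "pair_graph G" "X = abs_graph_class G"
      by (rule graph_class_cases)
    define k where "k = card (pverts G)"
    have "k \<le> n"
      using G \<open>X \<in> _\<close> by (simp add: class_order.abs_eq k_def)
    obtain f where f: "bij_betw f (pverts G) {..<k}"
      using finite_same_card_bij[OF finite_pverts[OF G(1)], of "{..<k}"] unfolding k_def by auto
    \<comment> \<open>The copy of \<open>G\<close> carried over to \<open>{..<k}\<close> by the
      enumeration \<open>f\<close> of its vertices.\<close>
    define G' where "G' = \<lparr>pverts = {..<k}, parcs = map_prod f f ` parcs G\<rparr>"
    have G'_T: "G' \<in> ?T k"
      using f G by (auto simp: G'_def bij_betw_def pair_graph_iff)
    have inj: "inj_on f (pverts G)"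
      using f by (simp add: bij_betw_def)
    have "pair_graph G'"
      unfolding pair_graph_iff
    proof (intro conjI allI impI)
      fix x y assume "(x, y) \<in> parcs G'"
      then obtain u v where uv: "(u, v) \<in> parcs G" "x = f u" "y = f v"
        by (auto simp: G'_def)
      with G have uv': "u \<in> pverts G" "v \<in> pverts G" "u \<noteq> v" "(v, u) \<in> parcs G"
        by (auto simp: pair_graph_iff)
      show "x \<in> pverts G'" "y \<in> pverts G'"
        using uv uv' f by (auto simp: G'_def bij_betw_def)
      show "x \<noteq> y"
        using uv uv' inj by (auto dest: inj_onD)
      show "(y, x) \<in> parcs G'"
        using uv uv' by (auto simp: G'_def)
    qed (simp add: G'_def)
    moreover have "vertex_iso f G G'"
      unfolding vertex_iso_def
    proof (intro conjI ballI)
      show "bij_betw f (pverts G) (pverts G')"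
        using f by (simp add: G'_def)
      fix u v assume "u \<in> pverts G" "v \<in> pverts G"
      then show "(u, v) \<in> parcs G \<longleftrightarrow> (f u, f v) \<in> parcs G'"
        using inj G by (auto simp: G'_def pair_graph_iff dest: inj_onD)
    qed
    ultimately have "X = abs_graph_class G'"
      using G abs_graph_class_eq_iff by auto
    with G'_T \<open>k \<le> n\<close> show "X \<in> abs_graph_class ` (\<Union>k\<in>{..n}. ?T k)"
      by blast
  qed
  then show ?thesis
    by (rule finite_subset) (use fin in simp)
qed


section \<open>Counting induced subgraphs\<close>

text \<open>An embedding with image \<open>S\<close> is an isomorphism onto the subgraph induced on
  \<open>S\<close>; composing with one fixed such isomorphism matches these embeddings with the
  automorphisms of \<open>H\<close>.\<close>

lemma embeddings_image:
  assumes H: "pair_graph H" and G: "pair_graph G" and S: "S \<subseteq> pverts G"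
  shows "card {f \<in> embeddings H G. f ` pverts H = S} =
    (if \<exists>f. vertex_iso f H (induced G S) then card (automorphisms H) else 0)"
proof (cases "\<exists>f. vertex_iso f H (induced G S)")
  case True
  then obtain f where f: "vertex_iso f H (induced G S)" ..
  have card: "card (pverts H) = card S"
    using f by (auto simp: vertex_iso_def dest: bij_betw_same_card)
  have finS: "finite S"
    using S G by (auto simp: pair_graph_iff intro: finite_subset)
  \<comment> \<open>Since \<open>H\<close> and \<open>S\<close> have equally many elements, every
    embedding into the induced subgraph is onto \<open>S\<close>.\<close>
  have "{f \<in> embeddings H G. f ` pverts H = S} = embeddings H (induced G S)"
  proof (intro equalityI subsetI)
    fix h assume "h \<in> {f \<in> embeddings H G. f ` pverts H = S}"
    then show "h \<in> embeddings H (induced G S)"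
      by (auto simp: embeddings_def)
  next
    fix h assume h: "h \<in> embeddings H (induced G S)"
    then have "h ` pverts H \<subseteq> S" "inj_on h (pverts H)"
      by (auto simp: embeddings_def)
    then have "h ` pverts H = S"
      using card finS by (simp add: card_image card_subset_eq)
    moreover have "h \<in> embeddings H G"
      using h S by (fastforce simp: embeddings_def)
    ultimately show "h \<in> {f \<in> embeddings H G. f ` pverts H = S}"
      by simp
  qed
  also have "card \<dots> = card (embeddings H H)"
    using card_embeddings_cong[OF H H H pair_graph_induced[OF G S] vertex_iso_id f] by simp
  finally show ?thesis
    using True by (simp add: automorphisms_eq_embeddings[OF H])
next
  case False
  have "{f \<in> embeddings H G. f ` pverts H = S} = {}"
  proof (rule ccontr)
    assume "{f \<in> embeddings H G. f ` pverts H = S} \<noteq> {}"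
    then obtain f where "f \<in> embeddings H G" "f ` pverts H = S"
      by blast
    then have "vertex_iso f H (induced G S)"
      by (auto simp: vertex_iso_def embeddings_def bij_betw_def)
    with False show False
      by blast
  qed
  then show ?thesis
    using False by (simp only: card.empty if_False)
qed

lemma card_automorphisms_pos:
  assumes "pair_graph H"
  shows "card (automorphisms H) > 0"
proof -
  \<comment> \<open>The identity is restricted because embeddings are extensional.\<close>
  have "restrict id (pverts H) \<in> embeddings H H"
    by (auto simp: embeddings_def inj_on_def)
  then show ?thesis
    using finite_embeddings[OF assms assms]
    by (auto simp: automorphisms_eq_embeddings[OF assms] card_gt_0_iff)
qed

text \<open>Embeddings are grouped by image. Each image inducing \<open>X\<close> accounts for as
  many embeddings as \<open>H\<close> has automorphisms, which cancels the denominator of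
  \<open>induced_count\<close>.\<close>

theorem graph_fun_eq_card:
  assumes G: "pair_graph G"
  shows "graph_fun X (abs_graph_class G) = of_nat (card {S. S \<subseteq> pverts G \<and> induced_class G S = X})"
proof -
  obtain H where H: "pair_graph H" "X = abs_graph_class H"
    by (rule graph_class_cases)
  let ?a = "card (automorphisms H)"
  have fin: "finite (Pow (pverts G))"
    using G by (simp add: pair_graph_iff)
  have "embeddings H G = (\<Union>S\<in>Pow (pverts G). {f \<in> embeddings H G. f ` pverts H = S})"
    by (auto simp: embeddings_def)
  then have "card (embeddings H G) =
      (\<Sum>S\<in>Pow (pverts G). card {f \<in> embeddings H G. f ` pverts H = S})"
    using card_UN_disjoint[OF fin, of "\<lambda>S. {f \<in> embeddings H G. f ` pverts H = S}"]
      finite_embeddings[OF H(1) G] by auto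
  also have "\<dots> = (\<Sum>S\<in>Pow (pverts G). if induced_class G S = X then ?a else 0)"
  proof (rule sum.cong[OF refl])
    fix S assume "S \<in> Pow (pverts G)"
    then have S: "S \<subseteq> pverts G" by simp
    show "card {f \<in> embeddings H G. f ` pverts H = S} = (if induced_class G S = X then ?a else 0)"
      using embeddings_image[OF H(1) G S]
        abs_graph_class_eq_iff[OF H(1) pair_graph_induced[OF G S]] H(2)
      by (simp add: induced_class_def eq_commute)
  qed
  also have "\<dots> = ?a * card {S. S \<subseteq> pverts G \<and> induced_class G S = X}"
    using fin by (simp add: sum.If_cases Int_def)
  finally show ?thesis
    using H G card_automorphisms_pos[OF H(1)]
    by (simp add: graph_fun.abs_eq induced_count_def)
qed

text \<open>The indicator form lets sums over vertex sets and over classes be interchanged.\<close>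

lemma graph_fun_eq_sum:
  assumes "pair_graph G"
  shows "graph_fun X (abs_graph_class G) = (\<Sum>S\<in>Pow (pverts G). if induced_class G S = X then 1 else 0)"
proof -
  have "finite (Pow (pverts G))"
    using assms by (simp add: pair_graph_iff)
  then show ?thesis
    by (simp add: graph_fun_eq_card[OF assms] sum.If_cases Int_def)
qed

lemma induced_class_verts: "pair_graph G \<Longrightarrow> induced_class G (pverts G) = abs_graph_class G"
  by (simp add: induced_class_def induced_verts)

section \<open>Triangularity of the functions with respect to order\<close>

lemma graph_fun_self: "graph_fun X X = 1"
proof -
  obtain G where G: "pair_graph G" "X = abs_graph_class G"
    by (rule graph_class_cases)
  have "S = pverts G" if "S \<subseteq> pverts G" "induced_class G S = X" for S
    using that G class_order_induced[of G S] card_subset_eq[of "pverts G" S]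
    by (simp add: class_order.abs_eq pair_graph_iff)
  then have "{S. S \<subseteq> pverts G \<and> induced_class G S = X} = {pverts G}"
    using G induced_class_verts by auto
  then show ?thesis
    using graph_fun_eq_card[OF G(1), of X] G(2) by simp
qed

text \<open>A copy of \<open>X\<close> in a graph that is no larger must use all its vertices, which
  would give \<open>X = Y\<close>.\<close>

lemma graph_fun_eq_0:
  assumes "class_order Y \<le> class_order X" "X \<noteq> Y"
  shows "graph_fun X Y = 0"
proof -
  obtain G where G: "pair_graph G" "Y = abs_graph_class G"
    by (rule graph_class_cases)
  have "S = pverts G" if "S \<subseteq> pverts G" "induced_class G S = X" for S
    using that G class_order_induced[of G S] assms(1) card_seteq[of "pverts G" S]
    by (simp add: class_order.abs_eq pair_graph_iff)
  then have "{S. S \<subseteq> pverts G \<and> induced_class G S = X} = {}"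
    using G induced_class_verts assms(2) by auto
  then show ?thesis
    using graph_fun_eq_card[OF G(1), of X] G(2) by (simp only: card.empty of_nat_0)
qed

lemma graph_fun_empty: "graph_fun (abs_graph_class \<lparr>pverts = {}, parcs = {}\<rparr>) = 1"
proof
  fix Y
  obtain G where G: "pair_graph G" "Y = abs_graph_class G"
    by (rule graph_class_cases)
  have "S = {}" if "S \<subseteq> pverts G" "induced_class G S = abs_graph_class \<lparr>pverts = {}, parcs = {}\<rparr>" for S
    using that G(1) class_order_induced[OF G(1) that(1)] finite_subset[OF that(1)]
    by (simp add: class_order.abs_eq pair_graph_empty pair_graph_iff[of G])
  then have "{S. S \<subseteq> pverts G \<and> induced_class G S = abs_graph_class \<lparr>pverts = {}, parcs = {}\<rparr>} = {{}}"
    by (auto simp: induced_class_def induced_def)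
  then show "graph_fun (abs_graph_class \<lparr>pverts = {}, parcs = {}\<rparr>) Y = 1 Y"
    using graph_fun_eq_card[OF G(1)] G(2) by simp
qed


section \<open>The product formula\<close>

text \<open>The two sets may overlap, and arcs between \<open>A - B\<close> and \<open>B - A\<close>
  are unrestricted; hence several classes occur in one product.\<close>

definition coverings ::
    "graph_class \<Rightarrow> graph_class \<Rightarrow> nat pair_pre_digraph \<Rightarrow> (nat set \<times> nat set) set" where
  "coverings X Y G =
     {(A, B). A \<union> B = pverts G \<and> induced_class G A = X \<and> induced_class G B = Y}"

lemma finite_coverings: "pair_graph G \<Longrightarrow> finite (coverings X Y G)"
  by (rule finite_subset[of _ "Pow (pverts G) \<times> Pow (pverts G)"])
    (auto simp: coverings_def pair_graph_iff)

text \<open>Images under an isomorphism carry coverings injectively to coverings. Applied also to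
  the inverse, this shows that the covering number depends only on the class.\<close>

lemma card_coverings_le:
  assumes "pair_graph G" "pair_graph H" "vertex_iso f G H"
  shows "card (coverings X Y G) \<le> card (coverings X Y H)"
proof (rule card_inj_on_le)
  have inj: "inj_on f (pverts G)" and im: "f ` pverts G = pverts H"
    using assms(3) by (auto simp: vertex_iso_def bij_betw_def)
  show "inj_on (\<lambda>(A, B). (f ` A, f ` B)) (coverings X Y G)"
  proof (rule inj_onI, clarsimp simp: coverings_def)
    fix A B A' B'
    assume "A \<union> B = pverts G" "A' \<union> B' = pverts G" "f ` A = f ` A'" "f ` B = f ` B'"
    then show "A = A' \<and> B = B'"
      using inj_on_image_eq_iff[OF inj] by blast
  qed
  show "(\<lambda>(A, B). (f ` A, f ` B)) ` coverings X Y G \<subseteq> coverings X Y H"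
  proof (clarsimp simp: coverings_def)
    fix A B assume AB: "A \<union> B = pverts G"
    then have "A \<subseteq> pverts G" "B \<subseteq> pverts G" by auto
    then show "f ` A \<union> f ` B = pverts H \<and> induced_class H (f ` A) = induced_class G A \<and>
        induced_class H (f ` B) = induced_class G B"
      using induced_class_iso[OF assms] im AB by (auto simp: image_Un[symmetric])
  qed
qed (rule finite_coverings[OF assms(2)])

text \<open>These numbers are the structure constants of multiplication on the functions
  \<open>[X]\<close>.\<close>

lift_definition covering_number :: "graph_class \<Rightarrow> graph_class \<Rightarrow> graph_class \<Rightarrow> nat"
  is "\<lambda>X Y G. card (coverings X Y G)"
  unfolding graph_iso_iff_vertex_iso
  by (meson card_coverings_le le_antisym vertex_iso_inv)

lemma covering_number_nonzero:
  assumes "pair_graph G" "covering_number X Y (abs_graph_class G) \<noteq> 0"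
  obtains A B where "A \<union> B = pverts G" "induced_class G A = X" "induced_class G B = Y"
proof -
  have "coverings X Y G \<noteq> {}"
    using assms by (auto simp: covering_number.abs_eq)
  then show ?thesis
    using that by (auto simp: coverings_def)
qed

lemma class_order_covering:
  assumes "covering_number X Y Z \<noteq> 0"
  shows "class_order Z \<le> class_order X + class_order Y"
proof -
  obtain G where G: "pair_graph G" "Z = abs_graph_class G"
    by (rule graph_class_cases)
  obtain A B where AB: "A \<union> B = pverts G" "induced_class G A = X" "induced_class G B = Y"
    using covering_number_nonzero G assms by metis
  have "class_order X = card A" "class_order Y = card B"
    using AB G class_order_induced by blast+
  then show ?thesis
    using G AB(1) card_Un_le[of A B] by (simp add: class_order.abs_eq)
qed

lemma finite_covering: "finite {Z. covering_number X Y Z \<noteq> 0}"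
  by (rule finite_subset[OF _ finite_classes_bounded[of "class_order X + class_order Y"]])
    (use class_order_covering in blast)

text \<open>A subset of \<open>S\<close> induces the same graph in \<open>induced G S\<close> as in
  \<open>G\<close>, so coverings of \<open>S\<close> can be counted inside \<open>G\<close>.\<close>

lemma covering_number_induced:
  assumes "pair_graph G" "S \<subseteq> pverts G"
  shows "covering_number X Y (induced_class G S) =
    card {(A, B). A \<union> B = S \<and> induced_class G A = X \<and> induced_class G B = Y}"
proof -
  have "coverings X Y (induced G S) =
      {(A, B). A \<union> B = S \<and> induced_class G A = X \<and> induced_class G B = Y}"
    by (auto simp: coverings_def induced_class_def induced_induced)
  then show ?thesis
    using assms by (simp add: induced_class_def covering_number.abs_eq pair_graph_induced)
qed

theorem graph_fun_mult:
  "graph_fun X * graph_fun Y =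
     (\<Sum>Z | covering_number X Y Z \<noteq> 0. scale_fun (of_nat (covering_number X Y Z)) (graph_fun Z))"
    (is "_ = ?rhs")
proof
  fix W
  obtain G where G: "pair_graph G" "W = abs_graph_class G"
    by (rule graph_class_cases)
  let ?P = "Pow (pverts G)"
  let ?F = "{Z. covering_number X Y Z \<noteq> 0}"
  let ?C = "\<lambda>S. {(A, B). A \<union> B = S \<and> induced_class G A = X \<and> induced_class G B = Y}"
  have fin: "finite ?P"
    using G by (simp add: pair_graph_iff)
  have finC: "finite (?C S)" if "S \<in> ?P" for S
    by (rule finite_subset[of _ "?P \<times> ?P"]) (use that fin in auto)
  let ?I = "\<lambda>X. {S. S \<subseteq> pverts G \<and> induced_class G S = X}"
  have sum_apply: "(\<Sum>Z\<in>F. f Z) W = (\<Sum>Z\<in>F. f Z W)" for F and f :: "graph_class \<Rightarrow> graph_class \<Rightarrow> rat"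
    by (induct F rule: infinite_finite_induct) auto
  have "(graph_fun X * graph_fun Y) W = of_nat (card (?I X \<times> ?I Y))"
    using G by (simp add: graph_fun_eq_card card_cartesian_product)
  also have "?I X \<times> ?I Y = (\<Union>S\<in>?P. ?C S)"
    by auto
  also have "card \<dots> = (\<Sum>S\<in>?P. card (?C S))"
    using fin finC by (intro card_UN_disjoint) auto
  also have "\<dots> = (\<Sum>S\<in>?P. covering_number X Y (induced_class G S))"
    using G by (intro sum.cong) (auto simp: covering_number_induced)
  \<comment> \<open>The inner sum picks out the class of \<open>S\<close>; if that class lies
    outside \<open>?F\<close>, both sides are zero.\<close>
  also have "of_nat \<dots> = (\<Sum>S\<in>?P. \<Sum>Z\<in>?F. of_nat (covering_number X Y Z) *
      (if induced_class G S = Z then 1 else 0 :: rat))"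
    unfolding of_nat_sum
  proof (rule sum.cong[OF refl])
    fix S
    show "of_nat (covering_number X Y (induced_class G S)) = (\<Sum>Z\<in>?F. of_nat (covering_number X Y Z) *
      (if induced_class G S = Z then 1 else 0 :: rat))"
      using finite_covering[of X Y] by (simp add: if_distrib sum.delta' cong: if_cong)
  qed
  also have "\<dots> = (\<Sum>Z\<in>?F. of_nat (covering_number X Y Z) * graph_fun Z W)"
    unfolding graph_fun_eq_sum[OF G(1)] G(2) sum_distrib_left by (rule sum.swap)
  also have "\<dots> = ?rhs W"
    by (simp add: sum_apply scale_fun_def)
  finally show "(graph_fun X * graph_fun Y) W = ?rhs W" .
qed


section \<open>Connected graphs\<close>

text \<open>Presents \<open>G\<close> as the disjoint union of the subgraphs induced on
  \<open>A\<close> and \<open>B\<close>. Either side may be empty.\<close>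

definition separates :: "'a pair_pre_digraph \<Rightarrow> 'a set \<Rightarrow> 'a set \<Rightarrow> bool" where
  "separates G A B \<longleftrightarrow> A \<union> B = pverts G \<and> A \<inter> B = {} \<and> parcs G \<subseteq> A \<times> A \<union> B \<times> B"

lemma separates_induced:
  "separates G A B \<Longrightarrow> S \<subseteq> pverts G \<Longrightarrow> separates (induced G S) (A \<inter> S) (B \<inter> S)"
  by (auto simp: separates_def)

text \<open>Replaces reachability by cuts: no walk crosses a separation, and conversely the vertices
  reachable from \<open>u\<close> form one side of a separation.\<close>

lemma connected_iff_separates:
  assumes G: "pair_graph G"
  shows "Digraph_Component.connected (with_proj G) \<longleftrightarrow>
    pverts G \<noteq> {} \<and> (\<forall>A B. separates G A B \<longrightarrow> A = {} \<or> B = {})"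
proof -
  interpret pair_graph G by fact
  \<comment> \<open>The arcs are already symmetric, so the symmetric closure in the library
    definition leaves reachability unchanged.\<close>
  have conn: "Digraph_Component.connected (with_proj G) \<longleftrightarrow>
      pverts G \<noteq> {} \<and> (\<forall>u\<in>pverts G. \<forall>v\<in>pverts G. u \<rightarrow>\<^sup>*\<^bsub>with_proj G\<^esub> v)"
    unfolding connected_def strongly_connected_def pverts_mk_symmetric with_proj_simps
      reachable_mk_symmetric_eq[OF sym_arcs] ..
  show ?thesis
    unfolding conn
  proof (intro conj_cong refl iffI allI impI ballI)
    fix A B
    assume reach: "\<forall>u\<in>pverts G. \<forall>v\<in>pverts G. u \<rightarrow>\<^sup>*\<^bsub>with_proj G\<^esub> v" and sep: "separates G A B"
    show "A = {} \<or> B = {}"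
    proof (rule ccontr)
      assume "\<not> (A = {} \<or> B = {})"
      then obtain a b where ab: "a \<in> A" "b \<in> B" by blast
      with reach sep have "a \<rightarrow>\<^sup>*\<^bsub>with_proj G\<^esub> b"
        by (auto simp: separates_def)
      \<comment> \<open>A walk that starts in \<open>A\<close> never leaves it.\<close>
      then have "b \<in> A"
        using ab(1) by (induct rule: reachable_induct) (use sep in \<open>auto simp: separates_def\<close>)
      with ab sep show False
        by (auto simp: separates_def)
    qed
  next
    fix u v
    assume "\<forall>A B. separates G A B \<longrightarrow> A = {} \<or> B = {}" and uv: "u \<in> pverts G" "v \<in> pverts G"
    moreover define A where "A = {w \<in> pverts G. u \<rightarrow>\<^sup>*\<^bsub>with_proj G\<^esub> w}"
    moreover have step: "x \<in> A \<longleftrightarrow> y \<in> A" if "(x, y) \<in> parcs G" for x y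
      using that in_arcsD1[OF that] in_arcsD2[OF that] arcs_symmetric[OF that]
        reachable_adj_trans[of u x y] reachable_adj_trans[of u y x]
      by (auto simp: A_def)
    have "separates G A (pverts G - A)"
      using step in_arcsD1 in_arcsD2 by (auto simp: separates_def A_def)
    moreover have "u \<in> A"
      using uv by (simp add: A_def)
    ultimately have "pverts G - A = {}"
      by blast
    with uv show "u \<rightarrow>\<^sup>*\<^bsub>with_proj G\<^esub> v"
      by (auto simp: A_def)
  qed
qed

text \<open>A connected induced subgraph cannot meet both sides, so each copy of \<open>X\<close>
  lies in exactly one of them.\<close>

lemma graph_fun_separates:
  assumes G: "pair_graph G" and sep: "separates G A B" and X: "connected_class X"
  shows "graph_fun X (abs_graph_class G) = graph_fun X (induced_class G A) + graph_fun X (induced_class G B)"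
proof -
  let ?I = "\<lambda>A. {S. S \<subseteq> A \<and> induced_class G S = X}"
  have AB: "A \<subseteq> pverts G" "B \<subseteq> pverts G"
    using sep by (auto simp: separates_def)
  have I: "graph_fun X (induced_class G T) = of_nat (card (?I T))" if "T \<subseteq> pverts G" for T
  proof -
    have "{S. S \<subseteq> T \<and> induced_class (induced G T) S = X} = ?I T"
      by (auto simp: induced_class_def induced_induced)
    then show ?thesis
      using graph_fun_eq_card[OF pair_graph_induced[OF G that], of X] by (simp add: induced_class_def[of G T])
  qed
  \<comment> \<open>Nonemptiness matters as well: it prevents a copy from being counted on both
    sides.\<close>
  have conn: "S \<noteq> {} \<and> (A \<inter> S = {} \<or> B \<inter> S = {})" if "S \<in> ?I (pverts G)" for S
  proof -
    have S: "S \<subseteq> pverts G" and XS: "X = abs_graph_class (induced G S)"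
      using that by (auto simp: induced_class_def)
    have "Digraph_Component.connected (with_proj (induced G S))"
      using X unfolding XS by (simp add: connected_class.abs_eq pair_graph_induced[OF G S])
    then show ?thesis
      using separates_induced[OF sep S] connected_iff_separates[OF pair_graph_induced[OF G S]]
      by auto
  qed
  have "?I (pverts G) = ?I A \<union> ?I B"
  proof (intro equalityI subsetI)
    fix S assume S: "S \<in> ?I (pverts G)"
    then show "S \<in> ?I A \<union> ?I B"
      using conn[OF S] sep by (auto simp: separates_def)
  qed (use AB in auto)
  moreover have "?I A \<inter> ?I B = {}"
  proof (rule ccontr)
    assume "?I A \<inter> ?I B \<noteq> {}"
    then obtain S where S: "S \<in> ?I A" "S \<in> ?I B" by blast
    with AB(1) have "S \<in> ?I (pverts G)" by auto
    with conn[OF this] S sep show False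
      by (auto simp: separates_def)
  qed
  moreover have "finite (?I A)" "finite (?I B)"
    using AB G finite_subset[of _ "pverts G"] by (simp_all add: pair_graph_iff)
  ultimately show ?thesis
    using I AB graph_fun_eq_card[OF G, of X] by (simp add: card_Un_disjoint)
qed

section \<open>Disjoint unions and their values on connected graphs\<close>

lemma ex_disjoint_union:
  "\<exists>Z. \<forall>X. connected_class X \<longrightarrow> graph_fun X Z = graph_fun X W + graph_fun X K"
proof -
  obtain G where G: "pair_graph G" "W = abs_graph_class G"
    by (rule graph_class_cases)
  obtain H where H: "pair_graph H" "K = abs_graph_class H"
    by (rule graph_class_cases)
  \<comment> \<open>Even and odd labels keep the two copies apart while staying within the natural
    numbers.\<close>
  let ?f = "\<lambda>x::nat. 2 * x" and ?g = "\<lambda>x::nat. 2 * x + 1"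
  define U where "U = \<lparr>pverts = ?f ` pverts G \<union> ?g ` pverts H,
    parcs = map_prod ?f ?f ` parcs G \<union> map_prod ?g ?g ` parcs H\<rparr>"
  have ne: "2 * x \<noteq> Suc (2 * y)" "Suc (2 * y) \<noteq> 2 * x" for x y :: nat
    by presburger+
  have U: "pair_graph U"
    using G(1) H(1) by (auto simp: pair_graph_iff U_def)
  have sep: "separates U (?f ` pverts G) (?g ` pverts H)"
    using G(1) H(1) ne by (auto simp: separates_def U_def pair_graph_iff)
  have sub: "?f ` pverts G \<subseteq> pverts U" "?g ` pverts H \<subseteq> pverts U"
    by (auto simp: U_def)
  have "vertex_iso ?f G (induced U (?f ` pverts G))"
    using ne by (auto simp: vertex_iso_def bij_betw_def inj_on_def U_def)
  then have "W = induced_class U (?f ` pverts G)"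
    unfolding induced_class_def G(2)
    using abs_graph_class_eq_iff[OF G(1) pair_graph_induced[OF U sub(1)]] by blast
  moreover have "vertex_iso ?g H (induced U (?g ` pverts H))"
    using ne by (auto simp: vertex_iso_def bij_betw_def inj_on_def U_def)
  then have "K = induced_class U (?g ` pverts H)"
    unfolding induced_class_def H(2)
    using abs_graph_class_eq_iff[OF H(1) pair_graph_induced[OF U sub(2)]] by blast
  ultimately show ?thesis
    using graph_fun_separates[OF U sep] by auto
qed

lemma ex_disjoint_copies:
  "\<exists>Z. \<forall>X. connected_class X \<longrightarrow> graph_fun X Z = graph_fun X W + of_nat t * graph_fun X K"
proof (induct t)
  case 0
  show ?case by (intro exI[of _ W]) simp
next
  case (Suc t)
  then obtain Z where Z: "\<forall>X. connected_class X \<longrightarrow> graph_fun X Z = graph_fun X W + of_nat t * graph_fun X K"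
    by blast
  obtain Z' where "\<forall>X. connected_class X \<longrightarrow> graph_fun X Z' = graph_fun X Z + graph_fun X K"
    using ex_disjoint_union by blast
  with Z show ?case
    by (intro exI[of _ Z']) (simp add: algebra_simps)
qed


section \<open>Generation\<close>

text \<open>Isomorphisms of the two sides glue to one of the whole graphs, since neither graph has
  an arc across its separation.\<close>

lemma separates_iso:
  assumes G: "pair_graph G" "separates G A B" and H: "pair_graph H" "separates H C D"
    and eq: "induced_class G A = induced_class H C" "induced_class G B = induced_class H D"
  shows "abs_graph_class G = abs_graph_class H"
proof -
  have sub: "A \<subseteq> pverts G" "B \<subseteq> pverts G" "C \<subseteq> pverts H" "D \<subseteq> pverts H"
    using assms by (auto simp: separates_def)
  obtain f where f: "vertex_iso f (induced G A) (induced H C)"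
    using eq(1) sub G H by (auto simp: induced_class_def abs_graph_class_eq_iff pair_graph_induced)
  obtain g where g: "vertex_iso g (induced G B) (induced H D)"
    using eq(2) sub G H by (auto simp: induced_class_def abs_graph_class_eq_iff pair_graph_induced)
  define h where "h x = (if x \<in> A then f x else g x)" for x
  have disj: "A \<inter> B = {}" "C \<inter> D = {}"
    using assms by (auto simp: separates_def)
  have hf: "bij_betw h A C"
    using f bij_betw_cong[of A h f C] by (simp add: vertex_iso_def h_def)
  have "bij_betw h B D \<longleftrightarrow> bij_betw g B D"
    using disj by (intro bij_betw_cong) (auto simp: h_def)
  then have hg: "bij_betw h B D"
    using g by (auto simp: vertex_iso_def)
  have "bij_betw h (pverts G) (pverts H)"
    using bij_betw_combine[OF hf hg disj(2)] assms by (simp add: separates_def)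
  moreover have "(u, v) \<in> parcs G \<longleftrightarrow> (h u, h v) \<in> parcs H" if uv: "u \<in> pverts G" "v \<in> pverts G" for u v
  proof -
    have im: "\<And>x. x \<in> A \<Longrightarrow> h x \<in> C" "\<And>x. x \<in> B \<Longrightarrow> h x \<in> D"
      using hf hg by (auto simp: bij_betw_def)
    consider "u \<in> A" "v \<in> A" | "u \<in> B" "v \<in> B" | "u \<in> A" "v \<in> B" | "u \<in> B" "v \<in> A"
      using uv G by (auto simp: separates_def)
    then show ?thesis
    proof cases
      case 1
      then show ?thesis
        using f im[of u] im[of v] by (auto simp: vertex_iso_def h_def)
    next
      case 2
      then have "u \<notin> A" "v \<notin> A"
        using disj by auto
      with 2 show ?thesis
        using g im(2)[of u] im(2)[of v] by (auto simp: vertex_iso_def h_def)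
    next
      case 3
      then have "(u, v) \<notin> parcs G" "(h u, h v) \<notin> parcs H"
        using im(1)[of u] im(2)[of v] disj G(2) H(2) by (auto simp: separates_def)
      then show ?thesis by simp
    next
      case 4
      then have "(u, v) \<notin> parcs G" "(h u, h v) \<notin> parcs H"
        using im(1)[of v] im(2)[of u] disj G(2) H(2) by (auto simp: separates_def)
      then show ?thesis by simp
    qed
  qed
  ultimately have "vertex_iso h G H"
    by (simp add: vertex_iso_def)
  then show ?thesis
    using abs_graph_class_eq_iff[OF G(1) H(1)] by blast
qed

text \<open>
  Among the graphs occurring in a product, the disjoint union has the largest order and, among those
  of largest order, the fewest arcs.
\<close>

lemma covering_leading:
  assumes G: "pair_graph G" "separates G A B"
    and Z: "covering_number (induced_class G A) (induced_class G B) Z \<noteq> 0" "Z \<noteq> abs_graph_class G"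
  shows "class_order Z < card (pverts G) \<or>
    class_order Z = card (pverts G) \<and> card (parcs G) < class_size Z"
proof (cases "class_order Z < card (pverts G)")
  case False
  obtain H where H: "pair_graph H" "Z = abs_graph_class H"
    by (rule graph_class_cases)
  obtain C D where CD: "C \<union> D = pverts H" "induced_class H C = induced_class G A"
      "induced_class H D = induced_class G B"
    using covering_number_nonzero H Z(1) by metis
  have sub: "A \<subseteq> pverts G" "B \<subseteq> pverts G" "C \<subseteq> pverts H" "D \<subseteq> pverts H"
    using CD G by (auto simp: separates_def)
  have fin: "finite A" "finite B" "finite C" "finite D"
    using sub G H by (auto simp: pair_graph_iff intro: finite_subset)
  have ord: "card C = card A" "card D = card B"
    using CD sub G H class_order_induced by metis+
  have size: "card (parcs H \<inter> C \<times> C) = card (parcs G \<inter> A \<times> A)"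
      "card (parcs H \<inter> D \<times> D) = card (parcs G \<inter> B \<times> B)"
    using CD sub G H class_size_induced by metis+
  have "card (pverts G) = card A + card B"
    using G fin card_Un_disjoint[of A B] by (simp add: separates_def)
  moreover have "class_order Z = card (C \<union> D)"
    using H CD by (simp add: class_order.abs_eq)
  \<comment> \<open>The orders of \<open>C \<union> D\<close> and \<open>C \<inter> D\<close> add up
    to the order of \<open>G\<close>, so a union of full order forces disjointness.\<close>
  ultimately have Zord: "class_order Z = card (pverts G)" and "card (C \<inter> D) = 0"
    using False ord card_Un_Int[OF fin(3,4)] by linarith+
  then have disj: "C \<inter> D = {}"
    using fin by simp
  let ?E = "(parcs H \<inter> C \<times> C) \<union> (parcs H \<inter> D \<times> D)"
  \<comment> \<open>The arcs inside \<open>C\<close> and inside \<open>D\<close> are as many as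
    those of \<open>G\<close>; \<open>H\<close> must have a further arc across, or it would be
    isomorphic to \<open>G\<close>.\<close>
  have "\<not> parcs H \<subseteq> ?E"
  proof
    assume "parcs H \<subseteq> ?E"
    then have "separates H C D"
      using CD disj by (auto simp: separates_def)
    then have "Z = abs_graph_class G"
      using separates_iso[OF H(1) _ G] CD H(2) by auto
    with Z(2) show False by simp
  qed
  then have "card ?E < card (parcs H)"
    using finite_parcs[OF H(1)] by (intro psubset_card_mono) auto
  moreover have "card ?E = card (parcs H \<inter> C \<times> C) + card (parcs H \<inter> D \<times> D)"
    using disj fin by (intro card_Un_disjoint) auto
  moreover have "parcs G = (parcs G \<inter> A \<times> A) \<union> (parcs G \<inter> B \<times> B)"
    using G(2) by (auto simp: separates_def)
  then have "card (parcs G) = card (parcs G \<inter> A \<times> A) + card (parcs G \<inter> B \<times> B)"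
    using G(2) fin card_Un_disjoint[of "parcs G \<inter> A \<times> A" "parcs G \<inter> B \<times> B"]
    by (auto simp: separates_def)
  ultimately show ?thesis
    using size Zord H by (simp add: class_size.abs_eq)
qed simp

text \<open>A disconnected \<open>X\<close> occurs in the product of its two sides. All other terms
  precede it in the lexicographic order by order and then by number of missing arcs, so
  \<open>[X]\<close> can be solved for.\<close>

lemma graph_fun_in_subalgebra:
  assumes A: "subalgebra A" and conn: "graph_fun ` {X. connected_class X} \<subseteq> A"
  shows "graph_fun X \<in> A"
proof (induct X rule: wf_induct_rule[OF wf_measures[of "[class_order, \<lambda>X. class_order X * class_order X - class_size X]"]])
  case (1 X)
  have sub: "rat_fun.subspace A"
    using A by (simp add: subalgebra_def)
  obtain G where G: "pair_graph G" "X = abs_graph_class G"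
    by (rule graph_class_cases)
  consider "pverts G = {}" | "connected_class X" |
    A B where "separates G A B" "A \<noteq> {}" "B \<noteq> {}"
    using G connected_iff_separates[OF G(1)] by (auto simp: connected_class.abs_eq)
  then show ?case
  proof cases
    case 1
    then have "G = \<lparr>pverts = {}, parcs = {}\<rparr>"
      using G(1) by (cases G) (auto simp: pair_graph_iff)
    then show ?thesis
      using graph_fun_empty G(2) A unfolding subalgebra_def by metis
  next
    case 2
    then show ?thesis using conn by auto
  next
    case (3 C D)
    let ?Y = "induced_class G C" and ?Z = "induced_class G D"
    let ?c = "\<lambda>W. of_nat (covering_number ?Y ?Z W) :: rat"
    let ?F = "{W. covering_number ?Y ?Z W \<noteq> 0}"
    have CD: "C \<subseteq> pverts G" "D \<subseteq> pverts G" "C \<subset> pverts G" "D \<subset> pverts G"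
      using 3 by (auto simp: separates_def)
    have fin: "finite (pverts G)"
      using G by (simp add: pair_graph_iff)
    have "class_order ?Y < class_order X" "class_order ?Z < class_order X"
      using G CD psubset_card_mono[OF fin] by (simp_all add: class_order_induced class_order.abs_eq)
    then have "graph_fun ?Y \<in> A" "graph_fun ?Z \<in> A"
      using 1 by simp_all
    then have prod: "graph_fun ?Y * graph_fun ?Z \<in> A"
      using A by (simp add: subalgebra_def)
    \<comment> \<open>The separation itself is a covering, which makes the coefficient of
      \<open>[X]\<close> nonzero.\<close>
    have "(C, D) \<in> coverings ?Y ?Z G"
      using 3 by (simp add: coverings_def separates_def)
    then have X: "X \<in> ?F"
      using finite_coverings[OF G(1)] G card_gt_0_iff[of "coverings ?Y ?Z G"]
      by (auto simp: covering_number.abs_eq)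
    have "graph_fun W \<in> A" if W: "W \<in> ?F - {X}" for W
    proof -
      have "class_order W < class_order X \<or> class_order W = class_order X \<and> class_size X < class_size W"
        using covering_leading[OF G(1) 3(1), of W] W G
        by (simp add: class_order.abs_eq class_size.abs_eq)
      \<comment> \<open>At equal order, more arcs mean a strictly smaller second measure:
        \<open>class_size_le\<close> rules out truncation at zero.\<close>
      then show ?thesis
        using 1 class_size_le[of W] by auto
    qed
    then have rest: "(\<Sum>W\<in>?F - {X}. scale_fun (?c W) (graph_fun W)) \<in> A"
      using sub by (intro rat_fun.subspace_sum rat_fun.subspace_scale) auto
    have "graph_fun ?Y * graph_fun ?Z =
        scale_fun (?c X) (graph_fun X) + (\<Sum>W\<in>?F - {X}. scale_fun (?c W) (graph_fun W))"
      unfolding graph_fun_mult using sum.remove[OF finite_covering X] by simp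
    then have "scale_fun (?c X) (graph_fun X) =
        graph_fun ?Y * graph_fun ?Z - (\<Sum>W\<in>?F - {X}. scale_fun (?c W) (graph_fun W))"
      by simp
    also have "\<dots> \<in> A"
      using sub prod rest by (rule rat_fun.subspace_diff)
    \<comment> \<open>Rational scalars allow division by the leading coefficient.\<close>
    finally have "scale_fun (1 / ?c X) (scale_fun (?c X) (graph_fun X)) \<in> A"
      by (rule rat_fun.subspace_scale[OF sub])
    moreover have "scale_fun (1 / ?c X) (scale_fun (?c X) (graph_fun X)) = graph_fun X"
      using X by (simp add: scale_fun_def)
    ultimately show ?thesis
      by (simp only:)
  qed
qed

section \<open>Closure of the span under products\<close>

lemma subspace_mult_preimage:
  assumes "rat_fun.subspace A"
  shows "rat_fun.subspace {f. f * g \<in> A}"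
proof (rule rat_fun.subspaceI)
  show "0 \<in> {f. f * g \<in> A}"
    using rat_fun.subspace_0[OF assms] by (simp only: mem_Collect_eq mult_zero_left)
  show "x + y \<in> {f. f * g \<in> A}" if "x \<in> {f. f * g \<in> A}" "y \<in> {f. f * g \<in> A}" for x y
    using that rat_fun.subspace_add[OF assms] by (simp only: mem_Collect_eq distrib_right)
  show "scale_fun c x \<in> {f. f * g \<in> A}" if "x \<in> {f. f * g \<in> A}" for c x
  proof -
    have "scale_fun c x * g = scale_fun c (x * g)"
      by (auto simp: scale_fun_def fun_eq_iff)
    then show ?thesis
      using that rat_fun.subspace_scale[OF assms] by (simp only: mem_Collect_eq)
  qed
qed

text \<open>The product formula settles generators; linearity extends closure first in one factor
  and then, by commutativity, in the other.\<close>

lemma subalgebra_graph_algebra: "subalgebra graph_algebra"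
proof -
  have sub: "rat_fun.subspace graph_algebra"
    unfolding graph_algebra_def by (rule rat_fun.subspace_span)
  have base: "graph_fun X \<in> graph_algebra" for X
    unfolding graph_algebra_def by (intro rat_fun.span_base) simp
  have prod: "graph_fun X * graph_fun Y \<in> graph_algebra" for X Y
    unfolding graph_fun_mult
    by (intro rat_fun.subspace_sum[OF sub] rat_fun.subspace_scale[OF sub] base)
  have extend: "f * g \<in> graph_algebra"
    if "f \<in> graph_algebra" "\<And>X. graph_fun X * g \<in> graph_algebra" for f g
  proof -
    \<comment> \<open>The functions whose product with \<open>g\<close> stays in the span form a
      subspace containing all generators.\<close>
    have "rat_fun.span (range graph_fun) \<subseteq> {f. f * g \<in> graph_algebra}"
      by (rule rat_fun.span_minimal[OF _ subspace_mult_preimage[OF sub]]) (use that(2) in blast)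
    then show ?thesis
      using that(1) unfolding graph_algebra_def by blast
  qed
  have "f * g \<in> graph_algebra" if "f \<in> graph_algebra" "g \<in> graph_algebra" for f g
  proof (rule extend[OF that(1)])
    fix X
    have "g * graph_fun X \<in> graph_algebra"
      using that(2) prod by (rule extend)
    then show "graph_fun X * g \<in> graph_algebra"
      by (subst mult.commute)
  qed
  moreover have "1 \<in> graph_algebra"
    using base graph_fun_empty by metis
  ultimately show ?thesis
    using sub unfolding subalgebra_def by blast
qed

lemma hull_connected: "subalgebra hull (graph_fun ` {X. connected_class X}) = graph_algebra"
proof (rule hull_unique)
  show "graph_fun ` {X. connected_class X} \<subseteq> graph_algebra"
    unfolding graph_algebra_def by (auto intro: rat_fun.span_base)
  show "subalgebra graph_algebra"
    by (rule subalgebra_graph_algebra)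
  fix A assume "graph_fun ` {X. connected_class X} \<subseteq> A" "subalgebra A"
  then show "graph_algebra \<subseteq> A"
    unfolding graph_algebra_def
    by (intro rat_fun.span_minimal) (auto simp: graph_fun_in_subalgebra subalgebra_def)
qed


section \<open>Algebraic independence\<close>

text \<open>The sum is a polynomial evaluated at the infinitely many points
  \<open>x + of_nat t\<close>, hence the zero polynomial. Several indices may share an exponent, so
  a coefficient is itself a sum.\<close>

lemma sum_shifted_powers_eq_0:
  fixes a :: "'m \<Rightarrow> rat"
  assumes fin: "finite M" and zero: "\<And>t::nat. (\<Sum>m\<in>M. a m * (x + of_nat t) ^ d m) = 0"
  shows "(\<Sum>m | m \<in> M \<and> d m = k. a m) = 0"
proof -
  define p where "p = (\<Sum>m\<in>M. monom (a m) (d m))"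
  have "poly p (x + of_nat t) = 0" for t
    using zero by (simp add: p_def poly_sum poly_monom)
  then have "range (\<lambda>t::nat. x + of_nat t) \<subseteq> {y. poly p y = 0}"
    by auto
  moreover have "infinite (range (\<lambda>t::nat. x + of_nat t))"
    by (intro range_inj_infinite) (auto simp: inj_on_def)
  ultimately have "p = 0"
    using poly_roots_finite finite_subset by blast
  then have "coeff p k = 0"
    by simp
  then show ?thesis
    using fin by (simp add: p_def coeff_sum sum.If_cases Int_def)
qed

lemma graph_fun_monomials_independent:
  assumes "finite I" "finite M" "\<forall>X\<in>I. connected_class X"
    and "\<And>m m'. m \<in> M \<Longrightarrow> m' \<in> M \<Longrightarrow> (\<forall>X\<in>I. e m X = e m' X) \<Longrightarrow> m = m'"
    and "\<And>W. (\<Sum>m\<in>M. c m * (\<Prod>X\<in>I. graph_fun X W ^ e m X)) = 0"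
  shows "\<forall>m\<in>M. c m = 0"
  using assms
proof (induct "card I" arbitrary: I M)
  case 0
  then have "I = {}" by simp
  show ?case
  proof
    fix m assume m: "m \<in> M"
    \<comment> \<open>Without variables all indices agree vacuously, and the relation reduces to its
      single constant term.\<close>
    then have "M = {m}"
      using 0(5) \<open>I = {}\<close> by auto
    then show "c m = 0"
      using 0(6) \<open>I = {}\<close> by simp
  qed
next
  case (Suc n)
  then have "I \<noteq> {}" by auto
  \<comment> \<open>Least order ensures that no other member of \<open>I\<close> occurs in
    \<open>K\<close>, so adding copies of \<open>K\<close> changes only the value of
    \<open>[K]\<close>.\<close>
  obtain K where K: "K \<in> I" "\<And>X. X \<in> I \<Longrightarrow> class_order K \<le> class_order X"
    using ex_min_if_finite[of "class_order ` I"] Suc(3) \<open>I \<noteq> {}\<close> by (metis arg_min_if_finite(1) arg_min_least)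
  define J where "J = I - {K}"
  have J: "finite J" "card J = n" "I = insert K J" "K \<notin> J"
    using Suc(2,3) K by (auto simp: J_def)
  show ?case
  proof
    fix m0 assume m0: "m0 \<in> M"
    \<comment> \<open>With the exponent of \<open>K\<close> fixed, indices that agree on
      \<open>J\<close> agree on \<open>I\<close>, so injectivity survives the removal of
      \<open>K\<close>.\<close>
    let ?M = "{m \<in> M. e m K = e m0 K}"
    have "\<forall>m\<in>?M. c m = 0"
    proof (rule Suc(1)[of J])
      show "n = card J" "finite J" "finite ?M" "\<forall>X\<in>J. connected_class X"
        using J Suc(4,5) by auto
      show "m = m'" if "m \<in> ?M" "m' \<in> ?M" "\<forall>X\<in>J. e m X = e m' X" for m m'
        using that Suc(6)[of m m'] J by auto
      fix W
      let ?a = "\<lambda>m. c m * (\<Prod>X\<in>J. graph_fun X W ^ e m X)"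
      have "(\<Sum>m\<in>M. ?a m * (graph_fun K W + of_nat t) ^ e m K) = 0" for t :: nat
      proof -
        obtain Z where Z: "\<And>X. connected_class X \<Longrightarrow> graph_fun X Z = graph_fun X W + of_nat t * graph_fun X K"
          using ex_disjoint_copies by blast
        have ZK: "graph_fun K Z = graph_fun K W + of_nat t"
          using Z[of K] Suc(5) K by (simp add: graph_fun_self)
        have ZJ: "graph_fun X Z = graph_fun X W" if "X \<in> J" for X
        proof -
          have "graph_fun X K = 0"
            using that K J by (intro graph_fun_eq_0) auto
          then show ?thesis
            using Z[of X] Suc(5) that J by simp
        qed
        have "0 = (\<Sum>m\<in>M. c m * (\<Prod>X\<in>I. graph_fun X Z ^ e m X))"
          using Suc(7) by simp
        also have "\<dots> = (\<Sum>m\<in>M. ?a m * (graph_fun K W + of_nat t) ^ e m K)"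
          using J ZJ by (intro sum.cong) (auto simp: ZK)
        finally show ?thesis by simp
      qed
      from sum_shifted_powers_eq_0[OF Suc(4) this, of "e m0 K"]
      show "(\<Sum>m\<in>?M. ?a m) = 0" .
    qed
    then show "c m0 = 0"
      using m0 by simp
  qed
qed

text \<open>Gives all monomials a common finite variable set; a variable absent from a monomial has
  exponent 0 and contributes the factor 1.\<close>

lemma eval_mpoly_apply:
  assumes "mpoly_vars p \<subseteq> I" "finite I"
  shows "eval_mpoly F p W =
    (\<Sum>m\<in>Poly_Mapping.keys p. Poly_Mapping.lookup p m * (\<Prod>i\<in>I. F i W ^ Poly_Mapping.lookup m i))"
proof -
  have sum_apply: "(\<Sum>z\<in>S. f z) W = (\<Sum>z\<in>S. f z W)" for S and f :: "'c \<Rightarrow> 'b \<Rightarrow> rat"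
    by (induct S rule: infinite_finite_induct) auto
  have prod_apply: "(\<Prod>z\<in>S. f z) W = (\<Prod>z\<in>S. f z W)" for S and f :: "'c \<Rightarrow> 'b \<Rightarrow> rat"
    by (induct S rule: infinite_finite_induct) auto
  have power_apply: "(f ^ n) W = f W ^ n" for f :: "'b \<Rightarrow> rat" and n
    by (induct n) auto
  have "(\<Prod>i\<in>Poly_Mapping.keys m. F i W ^ Poly_Mapping.lookup m i) =
      (\<Prod>i\<in>I. F i W ^ Poly_Mapping.lookup m i)" if "m \<in> Poly_Mapping.keys p" for m
  proof (intro prod.mono_neutral_left ballI)
    show "Poly_Mapping.keys m \<subseteq> I"
      using that assms by (auto simp: mpoly_vars_def)
  qed (use assms in \<open>auto simp: in_keys_iff\<close>)
  then show ?thesis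
    by (simp add: eval_mpoly_def sum_apply prod_apply power_apply scale_fun_def)
qed

lemma graph_fun_algebraically_independent:
  "algebraically_independent {X. connected_class X} graph_fun"
  unfolding algebraically_independent_def
proof (intro allI impI)
  fix p :: "graph_class rat_mpoly"
  assume vars: "mpoly_vars p \<subseteq> {X. connected_class X}" and zero: "eval_mpoly graph_fun p = 0"
  have fin: "finite (mpoly_vars p)"
    by (simp add: mpoly_vars_def)
  have "\<forall>m\<in>Poly_Mapping.keys p. Poly_Mapping.lookup p m = 0"
  proof (rule graph_fun_monomials_independent[OF fin])
    show "\<forall>X\<in>mpoly_vars p. connected_class X"
      using vars by auto
    show "m = m'" if "m \<in> Poly_Mapping.keys p" "m' \<in> Poly_Mapping.keys p"
      "\<forall>X\<in>mpoly_vars p. Poly_Mapping.lookup m X = Poly_Mapping.lookup m' X" for m m'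
    proof (rule poly_mapping_eqI)
      fix X
      show "Poly_Mapping.lookup m X = Poly_Mapping.lookup m' X"
      proof (cases "X \<in> mpoly_vars p")
        case False
        then have "X \<notin> Poly_Mapping.keys m" "X \<notin> Poly_Mapping.keys m'"
          using that by (auto simp: mpoly_vars_def)
        then show ?thesis by (simp add: in_keys_iff)
      qed (use that in simp)
    qed
    show "(\<Sum>m\<in>Poly_Mapping.keys p. Poly_Mapping.lookup p m *
        (\<Prod>X\<in>mpoly_vars p. graph_fun X W ^ Poly_Mapping.lookup m X)) = 0" for W
      using eval_mpoly_apply[OF subset_refl fin, of graph_fun W] zero by simp
  qed simp
  \<comment> \<open>Coefficients at keys are nonzero by definition, so there are no keys.\<close>
  then show "p = 0"
    by (intro poly_mapping_eqI) (auto simp: in_keys_iff)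
qed

theorem theorem1p2:
  shows "free_polynomial_algebra_on graph_algebra {H. connected_class H} graph_fun"
  unfolding free_polynomial_algebra_on_def
  using graph_fun_algebraically_independent hull_connected by blast

end
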